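(* (Subject-reduction.) Let $\equiv$ be a non-confusing congruence on types, let $\Gamma$ be a context, $A$ a type and $t$, $u$ schemes. If $\Gamma \vdash t : A$ and $t_{\Gamma} \rhd^* u_{\Gamma}$, then $\Gamma \vdash u : A$.
   Context: Fix a many-sorted first-order language: a set of sorts, function symbols with arities $\langle s_1,\ldots,s_n,s\rangle$, predicate symbols with arities $\langle s_1,\ldots,s_n\rangle$, and infinitely many variables of each sort. Terms of sort $s$: $a ::= x \mid f(a_1,\ldots,a_n)$ (sort-respecting). Types (propositions): $A ::= P(a_1,\ldots,a_n) \mid A \Rightarrow A' \mid \forall x\, A$, with the usual free/bound variables, $\alpha$-equivalence and capture-avoiding substitution $[a/x]$ on terms and types. A context is a finite SET of types (so $\Gamma\cup\{A\}=\Gamma$ when $A\in\Gamma$). A congruence $\equiv$ on types is fixed; it is non-confusing: if $A\equiv B$ then either at least one of $A,B$ is atomic, or both are implications, or both are universal quantifications; if $(A\Rightarrow A')\equiv(B\Rightarrow B')$ then $A\equiv B$ and $A'\equiv B'$; if $(\forall x\,A)\equiv(\forall x\,B)$ then $A\equiv B$. Schemes: $t ::= \mathbf{v}_A \mid \lambda_A t \mid (t\ t') \mid \Lambda x\, t \mid (t\ a)$, where $\mathbf{v}_A$ is the (unique, canonical) variable of type $A$ and $a$ is a term. Typing rules for $\Gamma\vdash t:A$: (ax) $\Gamma\vdash \mathbf{v}_A:A$ if $A\in\Gamma$; ($\Rightarrow$i) from $\Gamma\cup\{A\}\vdash t:B$ infer $\Gamma\vdash\lambda_A t:A\Rightarrow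 B$; ($\Rightarrow$e) from $\Gamma\vdash t:A\Rightarrow B$ and $\Gamma\vdash u:A$ infer $\Gamma\vdash(t\ u):B$; ($\forall$i) from $\Gamma\vdash t:A$ infer $\Gamma\vdash\Lambda x\,t:\forall x\,A$ provided $x$ is not free in $\Gamma$; ($\forall$e) from $\Gamma\vdash t:\forall x\,A$ infer $\Gamma\vdash(t\ a):[a/x]A$; (conv) from $\Gamma\vdash t:A$ infer $\Gamma\vdash t:B$ if $A\equiv B$. A scheme in context $t_\Gamma$ is a pair of a scheme $t$ and a context $\Gamma$ in which $t$ is well-typed. Substitution of term variables in schemes: $\theta\mathbf{v}_A=\mathbf{v}_{\theta A}$, $\theta(\lambda_A t)=\lambda_{\theta A}\theta t$, $\theta(u\ v)=(\theta u\ \theta v)$, $\theta(\Lambda x\,t)=\Lambda x'\,\theta([x'/x]t)$ with $x'$ fresh, $\theta(t\ a)=(\theta t\ \theta a)$. A scheme substitution $\sigma=[t_1/A_1,\ldots,t_n/A_n]$ is a finite map from types to schemes; its application to a scheme $t$ w.r.t. a context $\Gamma$ is a SET $\sigma_\Gamma t$ of schemes: $\sigma_\Gamma\mathbf{v}_A=\{\mathbf{v}_A,\sigma(A)\}$ if $A\in dom(\sigma)$ and $A\in\Gamma$; $\sigma_\Gamma\mathbf{v}_A=\{\sigma(A)\}$ if $A\in dom(\sigma)$ and $A\notin\Gamma$; $\sigma_\Gamma\mathbf{v}_A=\{\mathbf{v}_A\}$ if $A\notin dom(\sigma)$; $\sigma_\Gamma(\lambda_A t)=\lambda_A\,\sigma_{\Gamma\cup\{A\}}t$;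 $\sigma_\Gamma(u\ v)=(\sigma_\Gamma u\ \sigma_\Gamma v)$; $\sigma_\Gamma(\Lambda x\,t)=\Lambda x'\,\sigma_\Gamma([x'/x]t)$ with $x'$ occurring neither in $\Lambda x\,t$ nor in $\sigma$; $\sigma_\Gamma(t\ a)=(\sigma_\Gamma t\ a)$. Here for sets $S,S'$ of schemes, $\lambda_A S=\{\lambda_A t: t\in S\}$, $(S\ S')=\{(t\ t'):t\in S,t'\in S'\}$, etc. Reduction: top-level $((\lambda_A t)\ u)_\Gamma\longrightarrow v_\Gamma$ for every $v\in[u/A]_\Gamma t$, and $((\Lambda x\,t)\ a)_\Gamma\longrightarrow([a/x]t)_\Gamma$. One-step reduction $\rhd$ is the contextual closure: if $t_\Gamma\longrightarrow t'_\Gamma$ then $t_\Gamma\rhd t'_\Gamma$; if $t_\Gamma\rhd t'_\Gamma$ then $(t\ u)_\Gamma\rhd(t'\ u)_\Gamma$, $(t\ a)_\Gamma\rhd(t'\ a)_\Gamma$ and $(\Lambda x\,t)_\Gamma\rhd(\Lambda x\,t')_\Gamma$; if $u_\Gamma\rhd u'_\Gamma$ then $(t\ u)_\Gamma\rhd(t\ u')_\Gamma$; if $t_{\Gamma\cup\{A\}}\rhd t'_{\Gamma\cup\{A\}}$ then $(\lambda_A t)_\Gamma\rhd(\lambda_A t')_\Gamma$. $\rhd^*$ is the reflexive-transitive closure of $\rhd$.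
   Formalization: The congruence is also assumed closed under sort-respecting substitution [a/x], without which the claim fails, e.g. for (Λx λ_{P(x)} v_{P(x)}) c when P(x)≡Q(x) but P(c)≢Q(c); and reduction under Λx in Γ requires x not free in Γ. *)

theory Defs
  imports Main
begin

(* A language: the type 's is its set of sorts; the function and predicate symbols are the elements
   of the domains of the two partial maps, so that either set of symbols may be empty. *)
record ('s, 'f, 'p) lang =
  fun_arity :: "'f \<Rightarrow> ('s list \<times> 's) option"
  pred_arity :: "'p \<Rightarrow> 's list option"

(* A variable carries its sort as first component; there are infinitely many of each sort. *)
type_synonym 's var = "'s \<times> nat"

(* Locally nameless raw syntax. Free variables are named; bound occurrences are de Bruijn indices,
   so alpha-equivalent types and schemes are equal. The binders ForallB and TLamB record the sort of
   the bound variable. The constructions "for all x, A" and "Lambda x t" on named variables are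
   Forall x A and TLam x t below; only these are used to state the rules. Raw expressions with
   dangling indices are excluded by the predicates has_sort, wf_ty and wf_sch. *)
datatype ('s, 'f) trm = Var "'s var" | Bound nat | Fn 'f "('s, 'f) trm list"

datatype ('s, 'f, 'p) ty =
    Atom 'p "('s, 'f) trm list"
  | Imp "('s, 'f, 'p) ty" "('s, 'f, 'p) ty"
  | ForallB 's "('s, 'f, 'p) ty"

datatype ('s, 'f, 'p) sch =
    PVar "('s, 'f, 'p) ty"
  | PLam "('s, 'f, 'p) ty" "('s, 'f, 'p) sch"
  | PApp "('s, 'f, 'p) sch" "('s, 'f, 'p) sch"
  | TLamB 's "('s, 'f, 'p) sch"
  | TApp "('s, 'f, 'p) sch" "('s, 'f) trm"


primrec fv_trm :: "('s, 'f) trm \<Rightarrow> 's var set" where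
  "fv_trm (Var x) = {x}"
| "fv_trm (Bound n) = {}"
| "fv_trm (Fn f ts) = \<Union> (set (map fv_trm ts))"

primrec fv_ty :: "('s, 'f, 'p) ty \<Rightarrow> 's var set" where
  "fv_ty (Atom P ts) = \<Union> (set (map fv_trm ts))"
| "fv_ty (Imp A B) = fv_ty A \<union> fv_ty B"
| "fv_ty (ForallB s A) = fv_ty A"

primrec fv_sch :: "('s, 'f, 'p) sch \<Rightarrow> 's var set" where
  "fv_sch (PVar A) = fv_ty A"
| "fv_sch (PLam A t) = fv_ty A \<union> fv_sch t"
| "fv_sch (PApp t u) = fv_sch t \<union> fv_sch u"
| "fv_sch (TLamB s t) = fv_sch t"
| "fv_sch (TApp t a) = fv_sch t \<union> fv_trm a"

definition fv_ctx :: "('s, 'f, 'p) ty set \<Rightarrow> 's var set" where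
  "fv_ctx \<Gamma> = (\<Union>A\<in>\<Gamma>. fv_ty A)"


(* bind k x turns the free occurrences of x into the index of the k-th enclosing binder. *)
primrec bind_trm :: "nat \<Rightarrow> 's var \<Rightarrow> ('s, 'f) trm \<Rightarrow> ('s, 'f) trm" where
  "bind_trm k x (Var y) = (if y = x then Bound k else Var y)"
| "bind_trm k x (Bound n) = Bound n"
| "bind_trm k x (Fn f ts) = Fn f (map (bind_trm k x) ts)"

primrec bind_ty :: "nat \<Rightarrow> 's var \<Rightarrow> ('s, 'f, 'p) ty \<Rightarrow> ('s, 'f, 'p) ty" where
  "bind_ty k x (Atom P ts) = Atom P (map (bind_trm k x) ts)"
| "bind_ty k x (Imp A B) = Imp (bind_ty k x A) (bind_ty k x B)"
| "bind_ty k x (ForallB s A) = ForallB s (bind_ty (Suc k) x A)"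

primrec bind_sch :: "nat \<Rightarrow> 's var \<Rightarrow> ('s, 'f, 'p) sch \<Rightarrow> ('s, 'f, 'p) sch" where
  "bind_sch k x (PVar A) = PVar (bind_ty k x A)"
| "bind_sch k x (PLam A t) = PLam (bind_ty k x A) (bind_sch k x t)"
| "bind_sch k x (PApp t u) = PApp (bind_sch k x t) (bind_sch k x u)"
| "bind_sch k x (TLamB s t) = TLamB s (bind_sch (Suc k) x t)"
| "bind_sch k x (TApp t a) = TApp (bind_sch k x t) (bind_trm k x a)"

definition Forall :: "'s var \<Rightarrow> ('s, 'f, 'p) ty \<Rightarrow> ('s, 'f, 'p) ty" where
  "Forall x A = ForallB (fst x) (bind_ty 0 x A)"

definition TLam :: "'s var \<Rightarrow> ('s, 'f, 'p) sch \<Rightarrow> ('s, 'f, 'p) sch" where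
  "TLam x t = TLamB (fst x) (bind_sch 0 x t)"


inductive has_sort :: "('s, 'f, 'p) lang \<Rightarrow> ('s, 'f) trm \<Rightarrow> 's \<Rightarrow> bool" for L where
  "has_sort L (Var x) (fst x)"
| "fun_arity L f = Some (ss, s) \<Longrightarrow> list_all2 (has_sort L) ts ss \<Longrightarrow> has_sort L (Fn f ts) s"

inductive wf_ty :: "('s, 'f, 'p) lang \<Rightarrow> ('s, 'f, 'p) ty \<Rightarrow> bool" for L where
  "pred_arity L P = Some ss \<Longrightarrow> list_all2 (has_sort L) ts ss \<Longrightarrow> wf_ty L (Atom P ts)"
| "wf_ty L A \<Longrightarrow> wf_ty L B \<Longrightarrow> wf_ty L (Imp A B)"
| "wf_ty L A \<Longrightarrow> wf_ty L (Forall x A)"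

inductive wf_sch :: "('s, 'f, 'p) lang \<Rightarrow> ('s, 'f, 'p) sch \<Rightarrow> bool" for L where
  "wf_ty L A \<Longrightarrow> wf_sch L (PVar A)"
| "wf_ty L A \<Longrightarrow> wf_sch L t \<Longrightarrow> wf_sch L (PLam A t)"
| "wf_sch L t \<Longrightarrow> wf_sch L u \<Longrightarrow> wf_sch L (PApp t u)"
| "wf_sch L t \<Longrightarrow> wf_sch L (TLam x t)"
| "wf_sch L t \<Longrightarrow> has_sort L a s \<Longrightarrow> wf_sch L (TApp t a)"

definition is_ctx :: "('s, 'f, 'p) lang \<Rightarrow> ('s, 'f, 'p) ty set \<Rightarrow> bool" where
  "is_ctx L \<Gamma> \<longleftrightarrow> finite \<Gamma> \<and> (\<forall>A\<in>\<Gamma>. wf_ty L A)"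


(* Simultaneous substitution of terms for free variables. It cannot capture as long as the
   substituted terms have no dangling indices, hence whenever they satisfy has_sort. *)
primrec sub_trm :: "('s var \<Rightarrow> ('s, 'f) trm) \<Rightarrow> ('s, 'f) trm \<Rightarrow> ('s, 'f) trm" where
  "sub_trm \<theta> (Var x) = \<theta> x"
| "sub_trm \<theta> (Bound n) = Bound n"
| "sub_trm \<theta> (Fn f ts) = Fn f (map (sub_trm \<theta>) ts)"

primrec sub_ty :: "('s var \<Rightarrow> ('s, 'f) trm) \<Rightarrow> ('s, 'f, 'p) ty \<Rightarrow> ('s, 'f, 'p) ty" where
  "sub_ty \<theta> (Atom P ts) = Atom P (map (sub_trm \<theta>) ts)"
| "sub_ty \<theta> (Imp A B) = Imp (sub_ty \<theta> A) (sub_ty \<theta> B)"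
| "sub_ty \<theta> (ForallB s A) = ForallB s (sub_ty \<theta> A)"

primrec sub_sch :: "('s var \<Rightarrow> ('s, 'f) trm) \<Rightarrow> ('s, 'f, 'p) sch \<Rightarrow> ('s, 'f, 'p) sch" where
  "sub_sch \<theta> (PVar A) = PVar (sub_ty \<theta> A)"
| "sub_sch \<theta> (PLam A t) = PLam (sub_ty \<theta> A) (sub_sch \<theta> t)"
| "sub_sch \<theta> (PApp t u) = PApp (sub_sch \<theta> t) (sub_sch \<theta> u)"
| "sub_sch \<theta> (TLamB s t) = TLamB s (sub_sch \<theta> t)"
| "sub_sch \<theta> (TApp t a) = TApp (sub_sch \<theta> t) (sub_trm \<theta> a)"

(* The substitution [a/x]. *)
definition single :: "('s, 'f) trm \<Rightarrow> 's var \<Rightarrow> 's var \<Rightarrow> ('s, 'f) trm" where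
  "single a x = Var(x := a)"


(* A congruence on types, as a set of pairs. As usual for deduction modulo a congruence, it is
   compatible with the connectives and closed under substitution of terms for variables. *)
definition congruence ::
  "('s, 'f, 'p) lang \<Rightarrow> (('s, 'f, 'p) ty \<times> ('s, 'f, 'p) ty) set \<Rightarrow> bool" where
  "congruence L E \<longleftrightarrow>
     equiv {A. wf_ty L A} E \<and>
     (\<forall>A A' B B'. (A, B) \<in> E \<and> (A', B') \<in> E \<longrightarrow> (Imp A A', Imp B B') \<in> E) \<and>
     (\<forall>x A B. (A, B) \<in> E \<longrightarrow> (Forall x A, Forall x B) \<in> E) \<and>
     (\<forall>x a A B. (A, B) \<in> E \<and> has_sort L a (fst x) \<longrightarrow>
        (sub_ty (single a x) A, sub_ty (single a x) B) \<in> E)"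

definition non_confusing ::
  "('s, 'f, 'p) lang \<Rightarrow> (('s, 'f, 'p) ty \<times> ('s, 'f, 'p) ty) set \<Rightarrow> bool" where
  "non_confusing L E \<longleftrightarrow>
     (\<forall>A B. (A, B) \<in> E \<longrightarrow>
        (\<exists>P ts. A = Atom P ts) \<or> (\<exists>P ts. B = Atom P ts) \<or>
        ((\<exists>A1 A2. A = Imp A1 A2) \<and> (\<exists>B1 B2. B = Imp B1 B2)) \<or>
        ((\<exists>x A1. A = Forall x A1) \<and> (\<exists>y B1. B = Forall y B1))) \<and>
     (\<forall>A A' B B'. (Imp A A', Imp B B') \<in> E \<longrightarrow> (A, B) \<in> E \<and> (A', B') \<in> E) \<and>
     (\<forall>x A B. wf_ty L A \<and> wf_ty L B \<and> (Forall x A, Forall x B) \<in> E \<longrightarrow> (A, B) \<in> E)"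


(* In (ForallE), wf_ty L A rules out representations of the premise's type by a body with dangling
   indices. All other well-formedness conditions follow from those given here. *)
inductive typing ::
  "('s, 'f, 'p) lang \<Rightarrow> (('s, 'f, 'p) ty \<times> ('s, 'f, 'p) ty) set \<Rightarrow>
   ('s, 'f, 'p) ty set \<Rightarrow> ('s, 'f, 'p) sch \<Rightarrow> ('s, 'f, 'p) ty \<Rightarrow> bool" for L E where
  Ax: "is_ctx L \<Gamma> \<Longrightarrow> A \<in> \<Gamma> \<Longrightarrow> typing L E \<Gamma> (PVar A) A"
| ImpI: "typing L E (\<Gamma> \<union> {A}) t B \<Longrightarrow> typing L E \<Gamma> (PLam A t) (Imp A B)"
| ImpE: "typing L E \<Gamma> t (Imp A B) \<Longrightarrow> typing L E \<Gamma> u A \<Longrightarrow> typing L E \<Gamma> (PApp t u) B"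
| ForallI: "typing L E \<Gamma> t A \<Longrightarrow> x \<notin> fv_ctx \<Gamma> \<Longrightarrow> typing L E \<Gamma> (TLam x t) (Forall x A)"
| ForallE: "typing L E \<Gamma> t (Forall x A) \<Longrightarrow> wf_ty L A \<Longrightarrow> has_sort L a (fst x) \<Longrightarrow>
    typing L E \<Gamma> (TApp t a) (sub_ty (single a x) A)"
| Conv: "typing L E \<Gamma> t A \<Longrightarrow> (A, B) \<in> E \<Longrightarrow> typing L E \<Gamma> t B"


(* Scheme substitutions are finite maps; only singletons are needed below. *)
type_synonym ('s, 'f, 'p) ssub = "('s, 'f, 'p) ty \<rightharpoonup> ('s, 'f, 'p) sch"

definition fv_ssub :: "('s, 'f, 'p) ssub \<Rightarrow> 's var set" where
  "fv_ssub \<sigma> = (\<Union>A\<in>dom \<sigma>. fv_ty A) \<union> (\<Union>t\<in>ran \<sigma>. fv_sch t)"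

(* in_apply L \<sigma> \<Gamma> t v means that v belongs to the set obtained by applying \<sigma> to t with respect
   to \<Gamma>. The first two rules can both apply, which makes the set have several elements. *)
inductive in_apply ::
  "('s, 'f, 'p) lang \<Rightarrow> ('s, 'f, 'p) ssub \<Rightarrow> ('s, 'f, 'p) ty set \<Rightarrow>
   ('s, 'f, 'p) sch \<Rightarrow> ('s, 'f, 'p) sch \<Rightarrow> bool" for L \<sigma> where
  VarSub: "\<sigma> A = Some w \<Longrightarrow> in_apply L \<sigma> \<Gamma> (PVar A) w"
| VarKeep: "A \<in> dom \<sigma> \<Longrightarrow> A \<in> \<Gamma> \<Longrightarrow> in_apply L \<sigma> \<Gamma> (PVar A) (PVar A)"
| VarOther: "A \<notin> dom \<sigma> \<Longrightarrow> in_apply L \<sigma> \<Gamma> (PVar A) (PVar A)"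
| Lam: "in_apply L \<sigma> (\<Gamma> \<union> {A}) t v \<Longrightarrow> in_apply L \<sigma> \<Gamma> (PLam A t) (PLam A v)"
| App: "in_apply L \<sigma> \<Gamma> t v \<Longrightarrow> in_apply L \<sigma> \<Gamma> u w \<Longrightarrow> in_apply L \<sigma> \<Gamma> (PApp t u) (PApp v w)"
| Gen: "wf_sch L t \<Longrightarrow> x' \<notin> fv_sch (TLam x t) \<Longrightarrow> x' \<notin> fv_ssub \<sigma> \<Longrightarrow> fst x' = fst x \<Longrightarrow>
    in_apply L \<sigma> \<Gamma> (sub_sch (single (Var x') x) t) v \<Longrightarrow>
    in_apply L \<sigma> \<Gamma> (TLam x t) (TLam x' v)"
| Inst: "in_apply L \<sigma> \<Gamma> t v \<Longrightarrow> in_apply L \<sigma> \<Gamma> (TApp t a) (TApp v a)"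

definition apply_ssub ::
  "('s, 'f, 'p) lang \<Rightarrow> ('s, 'f, 'p) ssub \<Rightarrow> ('s, 'f, 'p) ty set \<Rightarrow>
   ('s, 'f, 'p) sch \<Rightarrow> ('s, 'f, 'p) sch set" where
  "apply_ssub L \<sigma> \<Gamma> t = {v. in_apply L \<sigma> \<Gamma> t v}"


inductive top_red ::
  "('s, 'f, 'p) lang \<Rightarrow> ('s, 'f, 'p) ty set \<Rightarrow> ('s, 'f, 'p) sch \<Rightarrow> ('s, 'f, 'p) sch \<Rightarrow> bool"
  for L where
  "v \<in> apply_ssub L [A \<mapsto> u] \<Gamma> t \<Longrightarrow> top_red L \<Gamma> (PApp (PLam A t) u) v"
| "wf_sch L t \<Longrightarrow> has_sort L a (fst x) \<Longrightarrow>
    top_red L \<Gamma> (TApp (TLam x t) a) (sub_sch (single a x) t)"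

(* In (GenBody), x must be chosen outside \<Gamma>, as in (ForallI): schemes being identified up to
   alpha-equivalence, the body of TLam x t may not share the bound variable with \<Gamma>. *)
inductive red ::
  "('s, 'f, 'p) lang \<Rightarrow> ('s, 'f, 'p) ty set \<Rightarrow> ('s, 'f, 'p) sch \<Rightarrow> ('s, 'f, 'p) sch \<Rightarrow> bool"
  for L where
  Top: "top_red L \<Gamma> t t' \<Longrightarrow> red L \<Gamma> t t'"
| AppL: "red L \<Gamma> t t' \<Longrightarrow> red L \<Gamma> (PApp t u) (PApp t' u)"
| InstFun: "red L \<Gamma> t t' \<Longrightarrow> red L \<Gamma> (TApp t a) (TApp t' a)"
| GenBody: "wf_sch L t \<Longrightarrow> x \<notin> fv_ctx \<Gamma> \<Longrightarrow> red L \<Gamma> t t' \<Longrightarrow> red L \<Gamma> (TLam x t) (TLam x t')"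
| AppR: "red L \<Gamma> u u' \<Longrightarrow> red L \<Gamma> (PApp t u) (PApp t u')"
| LamBody: "red L (\<Gamma> \<union> {A}) t t' \<Longrightarrow> red L \<Gamma> (PLam A t) (PLam A t')"

abbreviation reds ::
  "('s, 'f, 'p) lang \<Rightarrow> ('s, 'f, 'p) ty set \<Rightarrow> ('s, 'f, 'p) sch \<Rightarrow> ('s, 'f, 'p) sch \<Rightarrow> bool" where
  "reds L \<Gamma> \<equiv> (red L \<Gamma>)\<^sup>*\<^sup>*"


(* The named constructions behave as on alpha-equivalence classes: they have the expected free
   variables, the bound variable can be renamed, substitution goes under the binder after choosing
   a fresh bound variable, and, on well-formed expressions, two of them are equal only if they differ
   by such a renaming. *)

primrec lc_trm :: "nat \<Rightarrow> ('s, 'f) trm \<Rightarrow> bool" where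
  "lc_trm k (Var x) = True"
| "lc_trm k (Bound n) = (n < k)"
| "lc_trm k (Fn f ts) = list_all (lc_trm k) ts"

primrec lc_ty :: "nat \<Rightarrow> ('s, 'f, 'p) ty \<Rightarrow> bool" where
  "lc_ty k (Atom P ts) = list_all (lc_trm k) ts"
| "lc_ty k (Imp A B) = (lc_ty k A \<and> lc_ty k B)"
| "lc_ty k (ForallB s A) = lc_ty (Suc k) A"

primrec lc_sch :: "nat \<Rightarrow> ('s, 'f, 'p) sch \<Rightarrow> bool" where
  "lc_sch k (PVar A) = lc_ty k A"
| "lc_sch k (PLam A t) = (lc_ty k A \<and> lc_sch k t)"
| "lc_sch k (PApp t u) = (lc_sch k t \<and> lc_sch k u)"
| "lc_sch k (TLamB s t) = lc_sch (Suc k) t"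
| "lc_sch k (TApp t a) = (lc_sch k t \<and> lc_trm k a)"

lemma lc_bind_trm: "lc_trm k a \<Longrightarrow> lc_trm (Suc k) (bind_trm k x a)"
  by (induction a) (auto simp: list_all_iff)

lemma lc_bind_ty: "lc_ty k A \<Longrightarrow> lc_ty (Suc k) (bind_ty k x A)"
  by (induction A arbitrary: k) (auto simp: list_all_iff lc_bind_trm)

lemma lc_bind_sch: "lc_sch k t \<Longrightarrow> lc_sch (Suc k) (bind_sch k x t)"
  by (induction t arbitrary: k) (auto simp: lc_bind_trm lc_bind_ty)

lemma has_sort_lc: "has_sort L a s \<Longrightarrow> lc_trm k a"
  by (induction rule: has_sort.induct) (auto simp: list_all_iff list_all2_conv_all_nth in_set_conv_nth)

lemma wf_ty_lc: "wf_ty L A \<Longrightarrow> lc_ty 0 A"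
proof (induction rule: wf_ty.induct)
  case (1 P ss ts)
  then show ?case
    by (auto simp: list_all_iff list_all2_conv_all_nth in_set_conv_nth)
      (metis has_sort_lc)
next
  case (3 A x)
  then show ?case
    by (simp add: Forall_def lc_bind_ty)
qed auto

lemma wf_sch_lc: "wf_sch L t \<Longrightarrow> lc_sch 0 t"
  by (induction rule: wf_sch.induct) (simp_all add: TLam_def lc_bind_sch wf_ty_lc has_sort_lc)


lemma fv_bind_trm: "fv_trm (bind_trm k x a) = fv_trm a - {x}"
  by (induction a) auto

lemma fv_bind_ty: "fv_ty (bind_ty k x A) = fv_ty A - {x}"
  by (induction A arbitrary: k) (auto simp: fv_bind_trm)

lemma fv_bind_sch: "fv_sch (bind_sch k x t) = fv_sch t - {x}"
  by (induction t arbitrary: k) (auto simp: fv_bind_trm fv_bind_ty)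

lemma fv_Forall: "fv_ty (Forall x A) = fv_ty A - {x}"
  by (simp add: Forall_def fv_bind_ty)

lemma fv_TLam: "fv_sch (TLam x t) = fv_sch t - {x}"
  by (simp add: TLam_def fv_bind_sch)


lemma bind_rename_trm:
  "y \<notin> fv_trm a \<Longrightarrow> bind_trm k y (sub_trm (single (Var y) x) a) = bind_trm k x a"
  by (induction a) (auto simp: single_def)

lemma bind_rename_ty:
  "y \<notin> fv_ty A \<Longrightarrow> bind_ty k y (sub_ty (single (Var y) x) A) = bind_ty k x A"
  by (induction A arbitrary: k) (auto simp: bind_rename_trm)

lemma bind_rename_sch:
  "y \<notin> fv_sch t \<Longrightarrow> bind_sch k y (sub_sch (single (Var y) x) t) = bind_sch k x t"
  by (induction t arbitrary: k) (auto simp: bind_rename_trm bind_rename_ty)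

lemma Forall_rename:
  "y \<notin> fv_ty A \<Longrightarrow> fst y = fst x \<Longrightarrow> Forall y (sub_ty (single (Var y) x) A) = Forall x A"
  by (simp add: Forall_def bind_rename_ty)

lemma TLam_rename:
  "y \<notin> fv_sch t \<Longrightarrow> fst y = fst x \<Longrightarrow> TLam y (sub_sch (single (Var y) x) t) = TLam x t"
  by (simp add: TLam_def bind_rename_sch)


lemma bind_fresh_trm: "x \<notin> fv_trm a \<Longrightarrow> bind_trm k x a = a"
  by (induction a) (auto simp: map_idI)

lemma sub_bind_trm:
  "\<forall>y\<in>fv_trm a - {x}. x' \<notin> fv_trm (\<theta> y) \<Longrightarrow>
   sub_trm \<theta> (bind_trm k x a) = bind_trm k x' (sub_trm (\<theta>(x := Var x')) a)"
  by (induction a) (auto simp: bind_fresh_trm)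

lemma sub_bind_ty:
  "\<forall>y\<in>fv_ty A - {x}. x' \<notin> fv_trm (\<theta> y) \<Longrightarrow>
   sub_ty \<theta> (bind_ty k x A) = bind_ty k x' (sub_ty (\<theta>(x := Var x')) A)"
proof (induction A arbitrary: k)
  case (Atom P ts)
  then have "sub_trm \<theta> (bind_trm k x (Fn undefined ts)) =
      bind_trm k x' (sub_trm (\<theta>(x := Var x')) (Fn undefined ts))"
    by (intro sub_bind_trm) simp
  then show ?case by (simp add: fun_upd_def)
qed auto

lemma sub_bind_sch:
  "\<forall>y\<in>fv_sch t - {x}. x' \<notin> fv_trm (\<theta> y) \<Longrightarrow>
   sub_sch \<theta> (bind_sch k x t) = bind_sch k x' (sub_sch (\<theta>(x := Var x')) t)"
  by (induction t arbitrary: k) (auto simp: sub_bind_trm sub_bind_ty)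

lemma sub_Forall:
  "fst x' = fst x \<Longrightarrow> \<forall>y\<in>fv_ty (Forall x A). x' \<notin> fv_trm (\<theta> y) \<Longrightarrow>
   sub_ty \<theta> (Forall x A) = Forall x' (sub_ty (\<theta>(x := Var x')) A)"
  by (simp add: Forall_def sub_bind_ty fv_bind_ty)

lemma sub_TLam:
  "fst x' = fst x \<Longrightarrow> \<forall>y\<in>fv_sch (TLam x t). x' \<notin> fv_trm (\<theta> y) \<Longrightarrow>
   sub_sch \<theta> (TLam x t) = TLam x' (sub_sch (\<theta>(x := Var x')) t)"
  by (simp add: TLam_def sub_bind_sch fv_bind_sch)


lemma bind_inj_trm:
  "lc_trm k a \<Longrightarrow> lc_trm k b \<Longrightarrow> bind_trm k x a = bind_trm k y b \<Longrightarrow>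
   b = sub_trm (single (Var y) x) a"
proof (induction a arbitrary: b)
  case (Var z)
  then show ?case by (cases b) (auto simp: single_def split: if_splits)
next
  case (Bound n)
  then show ?case by (cases b) (auto split: if_splits)
next
  case (Fn f ts)
  then obtain us where b: "b = Fn f us" and eq: "map (bind_trm k x) ts = map (bind_trm k y) us"
    by (cases b) (auto split: if_splits)
  have "us = map (sub_trm (single (Var y) x)) ts"
  proof (rule nth_equalityI)
    show len: "length us = length (map (sub_trm (single (Var y) x)) ts)"
      using map_eq_imp_length_eq[OF eq] by simp
    fix i assume i: "i < length us"
    then have "bind_trm k x (ts ! i) = bind_trm k y (us ! i)"
      using arg_cong[OF eq, of "\<lambda>l. l ! i"] len by simp
    then show "us ! i = map (sub_trm (single (Var y) x)) ts ! i"
      using Fn len i b by (auto simp: list_all_iff)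
  qed
  then show ?case using b by simp
qed

lemma bind_inj_ty:
  "lc_ty k A \<Longrightarrow> lc_ty k B \<Longrightarrow> bind_ty k x A = bind_ty k y B \<Longrightarrow>
   B = sub_ty (single (Var y) x) A"
proof (induction A arbitrary: B k)
  case (Atom P ts)
  then obtain us where B: "B = Atom P us" by (cases B) auto
  have "Fn undefined us = sub_trm (single (Var y) x) (Fn undefined ts)"
    by (rule bind_inj_trm[of k]) (use Atom B in auto)
  then show ?case using B by simp
next
  case (Imp A1 A2)
  then show ?case by (cases B) auto
next
  case (ForallB s A)
  then show ?case by (cases B) auto
qed

lemma bind_inj_sch:
  "lc_sch k t \<Longrightarrow> lc_sch k u \<Longrightarrow> bind_sch k x t = bind_sch k y u \<Longrightarrow>
   u = sub_sch (single (Var y) x) t"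
proof (induction t arbitrary: u k)
  case (PVar A)
  then show ?case by (cases u) (auto dest: bind_inj_ty)
next
  case (PLam A t)
  then show ?case by (cases u) (auto dest: bind_inj_ty)
next
  case (PApp t1 t2)
  then show ?case by (cases u) auto
next
  case (TLamB s t)
  then show ?case by (cases u) auto
next
  case (TApp t a)
  then show ?case by (cases u) (auto dest: bind_inj_trm)
qed

lemma Forall_inj:
  assumes "wf_ty L A" and "wf_ty L B" and "Forall x A = Forall y B"
  shows "fst y = fst x" and "y = x \<or> y \<notin> fv_ty A" and "B = sub_ty (single (Var y) x) A"
proof -
  have "fv_ty A - {x} = fv_ty B - {y}"
    using assms(3) by (metis fv_Forall)
  then show "y = x \<or> y \<notin> fv_ty A" by blast
  show "fst y = fst x"
    using assms(3) by (simp add: Forall_def)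
  show "B = sub_ty (single (Var y) x) A"
    using assms by (intro bind_inj_ty[of 0]) (auto simp: Forall_def wf_ty_lc)
qed

lemma TLam_inj:
  assumes "wf_sch L t" and "wf_sch L u" and "TLam x t = TLam y u"
  shows "fst y = fst x" and "y = x \<or> y \<notin> fv_sch t" and "u = sub_sch (single (Var y) x) t"
proof -
  have "fv_sch t - {x} = fv_sch u - {y}"
    using assms(3) by (metis fv_TLam)
  then show "y = x \<or> y \<notin> fv_sch t" by blast
  show "fst y = fst x"
    using assms(3) by (simp add: TLam_def)
  show "u = sub_sch (single (Var y) x) t"
    using assms by (intro bind_inj_sch[of 0]) (auto simp: TLam_def wf_sch_lc)
qed

end

theory Submission
  imports Defs
begin

text \<open>
  Subject reduction is proved by inverting the typing derivation of the redex and applying a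
  substitution lemma. The delicate points all concern \<open>\<Lambda>\<close>. The type of a scheme may contain,
  through the congruence, variables that occur neither in the scheme nor in the context, so the
  bound variable of a \<open>\<Lambda>\<close> cannot always be taken to be the one displayed; the displayed variable
  is exchanged with a fresh one in the derivation of the body, and exchanged back afterwards.
  Likewise, the bound variable chosen when applying a scheme substitution may occur in the context;
  the hypotheses in which it occurs are then unused, and are removed before going under the binder.
\<close>

declare split_paired_All [simp del] split_paired_Ex [simp del]


section \<open>Free variables and substitution of terms\<close>

lemma finite_fv_trm: "finite (fv_trm a)"
  by (induction a) auto

lemma finite_fv_ty: "finite (fv_ty A)"
  by (induction A) (auto simp: finite_fv_trm)

lemma finite_fv_sch: "finite (fv_sch t)"
  by (induction t) (auto simp: finite_fv_trm finite_fv_ty)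

lemma finite_fv_ctx: "finite \<Gamma> \<Longrightarrow> finite (fv_ctx \<Gamma>)"
  by (simp add: fv_ctx_def finite_fv_ty)

lemmas finite_fv = finite_fv_trm finite_fv_ty finite_fv_sch

lemma fresh_var:
  assumes "finite (X :: 's var set)"
  obtains z where "z \<notin> X" and "fst z = s"
proof -
  have "infinite (range (Pair s) :: 's var set)"
    by (simp add: finite_image_iff inj_on_def)
  then obtain z where "z \<in> range (Pair s) - X"
    using assms by (metis Diff_infinite_finite finite.emptyI ex_in_conv)
  then show thesis using that by auto
qed

lemma sub_cong_trm:
  "\<forall>y\<in>fv_trm a. \<theta> y = \<eta> y \<Longrightarrow> sub_trm \<theta> a = sub_trm \<eta> a"
  by (induction a) auto

lemma sub_cong_ty:
  "\<forall>y\<in>fv_ty A. \<theta> y = \<eta> y \<Longrightarrow> sub_ty \<theta> A = sub_ty \<eta> A"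
  by (induction A) (auto intro!: sub_cong_trm)

lemma sub_cong_sch:
  "\<forall>y\<in>fv_sch t. \<theta> y = \<eta> y \<Longrightarrow> sub_sch \<theta> t = sub_sch \<eta> t"
  by (induction t) (auto intro!: sub_cong_trm sub_cong_ty)

lemma sub_Var_trm: "sub_trm Var a = a"
  by (induction a) (auto simp: map_idI)

lemma sub_Var_ty: "sub_ty Var A = A"
  by (induction A) (auto simp: sub_Var_trm map_idI)

lemma sub_Var_sch: "sub_sch Var t = t"
  by (induction t) (auto simp: sub_Var_trm sub_Var_ty)

lemma sub_id_trm: "\<forall>y\<in>fv_trm a. \<theta> y = Var y \<Longrightarrow> sub_trm \<theta> a = a"
  using sub_cong_trm[of a \<theta> Var] by (simp add: sub_Var_trm)

lemma sub_id_ty: "\<forall>y\<in>fv_ty A. \<theta> y = Var y \<Longrightarrow> sub_ty \<theta> A = A"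
  using sub_cong_ty[of A \<theta> Var] by (simp add: sub_Var_ty)

lemma sub_id_sch: "\<forall>y\<in>fv_sch t. \<theta> y = Var y \<Longrightarrow> sub_sch \<theta> t = t"
  using sub_cong_sch[of t \<theta> Var] by (simp add: sub_Var_sch)

lemma sub_sub_trm: "sub_trm \<theta> (sub_trm \<eta> a) = sub_trm (\<lambda>y. sub_trm \<theta> (\<eta> y)) a"
  by (induction a) auto

lemma sub_sub_ty: "sub_ty \<theta> (sub_ty \<eta> A) = sub_ty (\<lambda>y. sub_trm \<theta> (\<eta> y)) A"
  by (induction A) (auto simp: sub_sub_trm)

lemma sub_sub_sch: "sub_sch \<theta> (sub_sch \<eta> t) = sub_sch (\<lambda>y. sub_trm \<theta> (\<eta> y)) t"
  by (induction t) (auto simp: sub_sub_trm sub_sub_ty)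

lemma sub_fun_upd_fresh_ctx:
  "x \<notin> fv_ctx \<Gamma> \<Longrightarrow> sub_ty (\<theta>(x := a)) ` \<Gamma> = sub_ty \<theta> ` \<Gamma>"
  by (intro image_cong refl sub_cong_ty) (auto simp: fv_ctx_def)

lemma sub_id_ctx: "\<forall>y\<in>fv_ctx \<Gamma>. \<theta> y = Var y \<Longrightarrow> sub_ty \<theta> ` \<Gamma> = \<Gamma>"
  by (subst image_cong[OF refl, of _ _ id]) (auto simp: fv_ctx_def intro!: sub_id_ty)

text \<open>The rule \<open>Gen\<close> asks freshness for \<open>TLam x t\<close> only, so its new
  variable may be \<open>x\<close> itself even when \<open>x\<close> occurs in \<open>t\<close>;
  \<open>TLam_rename\<close> does not cover that case.\<close>

lemma TLam_rename':
  assumes "y \<notin> fv_sch (TLam x t)" and "fst y = fst x"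
  shows "TLam y (sub_sch (single (Var y) x) t) = TLam x t"
proof (cases "y = x")
  case True
  then have "sub_sch (single (Var y) x) t = t"
    by (intro sub_id_sch) (simp add: single_def)
  then show ?thesis using True by simp
next
  case False
  then show ?thesis using assms by (intro TLam_rename) (auto simp: fv_TLam)
qed


section \<open>Sorted substitutions\<close>

definition sorted_sub :: "('s, 'f, 'p) lang \<Rightarrow> ('s var \<Rightarrow> ('s, 'f) trm) \<Rightarrow> bool" where
  "sorted_sub L \<theta> \<longleftrightarrow> (\<forall>x. has_sort L (\<theta> x) (fst x))"

lemma sorted_sub_Var: "sorted_sub L Var"
  by (simp add: sorted_sub_def has_sort.intros)

lemma sorted_sub_upd:
  "sorted_sub L \<theta> \<Longrightarrow> has_sort L a (fst x) \<Longrightarrow> sorted_sub L (\<theta>(x := a))"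
  by (simp add: sorted_sub_def)

lemma sorted_sub_upd_Var:
  "sorted_sub L \<theta> \<Longrightarrow> fst y = fst x \<Longrightarrow> sorted_sub L (\<theta>(x := Var y))"
  by (metis sorted_sub_upd has_sort.intros(1))

lemma sorted_sub_single: "has_sort L a (fst x) \<Longrightarrow> sorted_sub L (single a x)"
  by (simp add: single_def sorted_sub_upd sorted_sub_Var)

lemma sorted_sub_single_Var: "fst y = fst x \<Longrightarrow> sorted_sub L (single (Var y) x)"
  by (simp add: single_def sorted_sub_upd_Var sorted_sub_Var)

text \<open>In a redex \<open>TApp (TLam x t) a\<close> the sort of \<open>a\<close> is given by the
  binder and again by the quantified type of the function; this makes the two sorts agree.\<close>

lemma has_sort_unique:
  assumes "has_sort L a s" and "has_sort L a r"
  shows "s = r"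
  using assms by (auto elim!: has_sort.cases)

lemma has_sort_sub:
  assumes "has_sort L a s" and "sorted_sub L \<theta>"
  shows "has_sort L (sub_trm \<theta> a) s"
  using assms
proof (induction rule: has_sort.induct)
  case (2 f ss s ts)
  then show ?case
    by (auto intro!: has_sort.intros simp: list_all2_conv_all_nth)
qed (simp add: sorted_sub_def)

text \<open>Under a quantifier the substitution is updated at the bound variable by a fresh one, so
  the induction ranges over all sorted substitutions.\<close>

lemma wf_ty_sub:
  assumes "wf_ty L A" and "sorted_sub L \<theta>"
  shows "wf_ty L (sub_ty \<theta> A)"
  using assms
proof (induction arbitrary: \<theta> rule: wf_ty.induct)
  case (1 P ss ts)
  then show ?case
    by (auto intro!: wf_ty.intros simp: list_all2_conv_all_nth has_sort_sub)
next
  case (2 A B)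
  then show ?case by (simp add: wf_ty.intros)
next
  case (3 A x)
  have "finite (\<Union>y\<in>fv_ty A. fv_trm (\<theta> y))"
    by (simp add: finite_fv)
  then obtain x' where x': "x' \<notin> (\<Union>y\<in>fv_ty A. fv_trm (\<theta> y))" "fst x' = fst x"
    by (rule fresh_var)
  then have "sub_ty \<theta> (Forall x A) = Forall x' (sub_ty (\<theta>(x := Var x')) A)"
    by (intro sub_Forall) (auto simp: fv_Forall)
  then show ?case
    using 3 x' by (auto intro!: wf_ty.intros sorted_sub_upd_Var)
qed

lemma wf_sch_sub:
  assumes "wf_sch L t" and "sorted_sub L \<theta>"
  shows "wf_sch L (sub_sch \<theta> t)"
  using assms
proof (induction arbitrary: \<theta> rule: wf_sch.induct)
  case (4 t x)
  have "finite (\<Union>y\<in>fv_sch t. fv_trm (\<theta> y))"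
    by (simp add: finite_fv)
  then obtain x' where x': "x' \<notin> (\<Union>y\<in>fv_sch t. fv_trm (\<theta> y))" "fst x' = fst x"
    by (rule fresh_var)
  then have "sub_sch \<theta> (TLam x t) = TLam x' (sub_sch (\<theta>(x := Var x')) t)"
    by (intro sub_TLam) (auto simp: fv_TLam)
  then show ?case
    using 4 x' by (auto intro!: wf_sch.intros sorted_sub_upd_Var)
qed (auto intro: wf_sch.intros wf_ty_sub has_sort_sub)

lemma is_ctx_sub: "is_ctx L \<Gamma> \<Longrightarrow> sorted_sub L \<theta> \<Longrightarrow> is_ctx L (sub_ty \<theta> ` \<Gamma>)"
  by (auto simp: is_ctx_def wf_ty_sub)

lemma is_ctx_insert: "is_ctx L (insert A \<Gamma>) \<longleftrightarrow> is_ctx L \<Gamma> \<and> wf_ty L A"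
  by (auto simp: is_ctx_def)

lemma is_ctx_subset: "is_ctx L \<Gamma> \<Longrightarrow> \<Gamma>' \<subseteq> \<Gamma> \<Longrightarrow> is_ctx L \<Gamma>'"
  by (auto simp: is_ctx_def intro: finite_subset)


section \<open>Typing modulo a congruence\<close>

locale type_congruence =
  fixes L :: "('s, 'f, 'p) lang"
    and E :: "(('s, 'f, 'p) ty \<times> ('s, 'f, 'p) ty) set"
  assumes congruence: "congruence L E"
begin

abbreviation has_type ::
  "('s, 'f, 'p) ty set \<Rightarrow> ('s, 'f, 'p) sch \<Rightarrow> ('s, 'f, 'p) ty \<Rightarrow> bool"
  ("_ \<turnstile> _ : _" [51, 51, 51] 50) where
  "\<Gamma> \<turnstile> t : A \<equiv> typing L E \<Gamma> t A"

section \<open>Closure of the congruence under simultaneous substitution\<close>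

lemma E_wf: "(A, B) \<in> E \<Longrightarrow> wf_ty L A \<and> wf_ty L B"
  using congruence by (auto simp: congruence_def equiv_def refl_on_def)

lemma E_refl: "wf_ty L A \<Longrightarrow> (A, A) \<in> E"
  using congruence by (auto simp: congruence_def equiv_def refl_on_def)

lemma E_sym: "(A, B) \<in> E \<Longrightarrow> (B, A) \<in> E"
  using congruence by (auto simp: congruence_def equiv_def sym_def)

lemma E_trans: "(A, B) \<in> E \<Longrightarrow> (B, C) \<in> E \<Longrightarrow> (A, C) \<in> E"
  using congruence by (auto simp: congruence_def equiv_def elim: transE)

lemma E_single:
  "(A, B) \<in> E \<Longrightarrow> has_sort L a (fst x) \<Longrightarrow> (sub_ty (single a x) A, sub_ty (single a x) B) \<in> E"
  using congruence unfolding congruence_def by blast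

text \<open>\<open>congruence\<close> provides closure under single substitutions only. When no
  image contains a variable of \<open>V\<close>, these can be performed one after another: a later
  one leaves the images already inserted unchanged.\<close>

lemma E_sub_idempotent:
  assumes "(A, B) \<in> E" and "finite V" and "sorted_sub L \<theta>"
    and "\<forall>x. x \<notin> V \<longrightarrow> \<theta> x = Var x" and "\<forall>x\<in>V. fv_trm (\<theta> x) \<inter> V = {}"
  shows "(sub_ty \<theta> A, sub_ty \<theta> B) \<in> E"
  using assms(2-)
proof (induction V arbitrary: \<theta> rule: finite_induct)
  case empty
  then show ?case using assms(1) by (simp add: sub_id_ty)
next
  case (insert x V)
  let ?\<eta> = "\<theta>(x := Var x)"
  have "(sub_ty ?\<eta> A, sub_ty ?\<eta> B) \<in> E"
    using insert.prems insert.hyps by (intro insert.IH sorted_sub_upd_Var) auto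
  moreover have "has_sort L (\<theta> x) (fst x)"
    using insert.prems by (simp add: sorted_sub_def)
  ultimately have "(sub_ty (single (\<theta> x) x) (sub_ty ?\<eta> A), sub_ty (single (\<theta> x) x) (sub_ty ?\<eta> B)) \<in> E"
    by (rule E_single)
  moreover have "sub_trm (single (\<theta> x) x) (?\<eta> y) = \<theta> y" for y
  proof (cases "y = x")
    case False
    then have "x \<notin> fv_trm (\<theta> y)"
      using insert.prems by (cases "y \<in> V") auto
    then show ?thesis
      using False by (auto simp: single_def intro!: sub_id_trm)
  qed (simp add: single_def)
  ultimately show ?case by (simp add: sub_sub_ty)
qed

text \<open>An arbitrary \<open>\<theta>\<close> may reintroduce variables that it also replaces. On
  the variables of \<open>A\<close> and \<open>B\<close> it factors as a renaming
  \<open>\<eta>1\<close> to fresh variables followed by a map \<open>\<eta>2\<close> from these to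
  the images, and both factors satisfy the disjointness condition of
  \<open>E_sub_idempotent\<close>.\<close>

lemma E_sub:
  assumes AB: "(A, B) \<in> E" and \<theta>: "sorted_sub L \<theta>"
  shows "(sub_ty \<theta> A, sub_ty \<theta> B) \<in> E"
proof -
  define V where "V = fv_ty A \<union> fv_ty B"
  define X where "X = V \<union> (\<Union>y\<in>V. fv_trm (\<theta> y))"
  have finV: "finite V" and finX: "finite X"
    by (auto simp: V_def X_def finite_fv)
  \<comment> \<open>Shifting indices by a bound \<open>N\<close> on all indices in \<open>X\<close>
    keeps sorts, lands outside \<open>X\<close>, and is inverted by the subtraction in
    \<open>\<eta>2\<close>.\<close>
  obtain N where N: "\<forall>x\<in>X. snd x < N"
    using finX finite_nat_set_iff_bounded[of "snd ` X"] by auto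
  define \<rho> :: "'s var \<Rightarrow> 's var" where "\<rho> x = (fst x, snd x + N)" for x
  define W where "W = \<rho> ` V"
  have WX: "W \<inter> X = {}"
    using N by (force simp: W_def \<rho>_def)
  define \<eta>1 where "\<eta>1 x = (if x \<in> V then Var (\<rho> x) else Var x :: ('s, 'f) trm)" for x
  define \<eta>2 where "\<eta>2 z = (if z \<in> W then \<theta> (fst z, snd z - N) else Var z)" for z
  have \<eta>2_\<rho>: "\<eta>2 (\<rho> x) = \<theta> x" if "x \<in> V" for x
    using that by (simp add: \<eta>2_def W_def) (simp add: \<rho>_def)
  have fv_\<eta>2: "fv_trm (\<eta>2 z) \<inter> W = {}" if "z \<in> W" for z
    using that WX \<eta>2_\<rho> by (force simp: W_def X_def)
  have "sorted_sub L \<eta>1"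
    unfolding sorted_sub_def
  proof
    fix x
    have "has_sort L (Var (\<rho> x)) (fst (\<rho> x))" by (rule has_sort.intros)
    then show "has_sort L (\<eta>1 x) (fst x)"
      by (auto simp: \<eta>1_def \<rho>_def intro: has_sort.intros)
  qed
  then have "(sub_ty \<eta>1 A, sub_ty \<eta>1 B) \<in> E"
    using finV WX by (intro E_sub_idempotent[OF AB]) (auto simp: \<eta>1_def W_def X_def)
  moreover have "sorted_sub L \<eta>2"
    unfolding sorted_sub_def
  proof
    fix z
    have "has_sort L (\<theta> (fst z, snd z - N)) (fst z)"
      using \<theta> unfolding sorted_sub_def by (metis fst_conv)
    then show "has_sort L (\<eta>2 z) (fst z)"
      by (auto simp: \<eta>2_def intro: has_sort.intros)
  qed
  moreover have "\<forall>z. z \<notin> W \<longrightarrow> \<eta>2 z = Var z" "\<forall>z\<in>W. fv_trm (\<eta>2 z) \<inter> W = {}" "finite W"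
    using finV fv_\<eta>2 by (auto simp: W_def \<eta>2_def)
  ultimately have "(sub_ty \<eta>2 (sub_ty \<eta>1 A), sub_ty \<eta>2 (sub_ty \<eta>1 B)) \<in> E"
    using E_sub_idempotent[where V = W and \<theta> = \<eta>2] by blast
  moreover have "sub_trm \<eta>2 (\<eta>1 x) = \<theta> x" if "x \<in> V" for x
    using that \<eta>2_\<rho> by (simp add: \<eta>1_def)
  then have "sub_ty \<eta>2 (sub_ty \<eta>1 A) = sub_ty \<theta> A" "sub_ty \<eta>2 (sub_ty \<eta>1 B) = sub_ty \<theta> B"
    by (auto simp: sub_sub_ty V_def intro!: sub_cong_ty)
  ultimately show ?thesis by simp
qed

section \<open>Substitution, weakening and strengthening of typing derivations\<close>

lemma typing_wf:
  "\<Gamma> \<turnstile> t : A \<Longrightarrow> is_ctx L \<Gamma> \<and> wf_sch L t \<and> wf_ty L A"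
proof (induction rule: typing.induct)
  case (Ax \<Gamma> A)
  then show ?case by (auto simp: is_ctx_def intro: wf_sch.intros)
next
  case (ImpE \<Gamma> t A B u)
  then show ?case by (auto simp: Forall_def intro: wf_sch.intros elim: wf_ty.cases)
next
  case (ForallE \<Gamma> t x A a)
  then show ?case by (auto intro: wf_sch.intros wf_ty_sub sorted_sub_single)
next
  case (Conv \<Gamma> t A B)
  then show ?case by (auto dest: E_wf)
qed (auto simp: is_ctx_insert intro: wf_sch.intros wf_ty.intros)

text \<open>Weakening is included: proving it separately would need the renaming of bound variables that
  the enlarged context captures, which is already an instance of this statement.\<close>

lemma typing_sub:
  assumes "\<Gamma> \<turnstile> t : A" and "sorted_sub L \<theta>" and "sub_ty \<theta> ` \<Gamma> \<subseteq> \<Delta>" and "is_ctx L \<Delta>"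
  shows "\<Delta> \<turnstile> sub_sch \<theta> t : sub_ty \<theta> A"
  using assms
proof (induction arbitrary: \<theta> \<Delta> rule: typing.induct)
  case (Ax \<Gamma> A)
  then show ?case by (auto intro: typing.Ax)
next
  case (ImpI \<Gamma> A t B)
  have "wf_ty L A"
    using typing_wf[OF ImpI.hyps] by (simp add: is_ctx_insert)
  then have "is_ctx L (\<Delta> \<union> {sub_ty \<theta> A})"
    using ImpI.prems by (simp add: is_ctx_insert wf_ty_sub)
  then show ?case
    using ImpI.prems by (auto intro!: typing.ImpI ImpI.IH)
next
  case (ImpE \<Gamma> t A B u)
  then show ?case using typing.ImpE[OF ImpE.IH(1)[simplified] ImpE.IH(2)] by simp
next
  case (ForallI \<Gamma> t A x)
  \<comment> \<open>Images of the variables of \<open>A\<close> are avoided as well as those of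
    \<open>t\<close>, since \<open>A\<close> may have free variables that do not occur in
    \<open>t\<close>.\<close>
  let ?X = "fv_ctx \<Delta> \<union> (\<Union>y\<in>fv_sch t \<union> fv_ty A. fv_trm (\<theta> y))"
  have "finite ?X"
    using ForallI.prems by (simp add: finite_fv finite_fv_ctx is_ctx_def)
  then obtain x' where x': "x' \<notin> ?X" "fst x' = fst x"
    by (rule fresh_var)
  have "sub_ty (\<theta>(x := Var x')) ` \<Gamma> \<subseteq> \<Delta>"
    using sub_fun_upd_fresh_ctx[OF ForallI.hyps(2)] ForallI.prems(2) by metis
  then have "\<Delta> \<turnstile> sub_sch (\<theta>(x := Var x')) t : sub_ty (\<theta>(x := Var x')) A"
    using ForallI.prems x' by (intro ForallI.IH[OF sorted_sub_upd_Var])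
  then have "\<Delta> \<turnstile> TLam x' (sub_sch (\<theta>(x := Var x')) t) : Forall x' (sub_ty (\<theta>(x := Var x')) A)"
    using x' by (intro typing.ForallI) auto
  moreover have "sub_sch \<theta> (TLam x t) = TLam x' (sub_sch (\<theta>(x := Var x')) t)"
    using x' by (intro sub_TLam) (auto simp: fv_TLam)
  moreover have "sub_ty \<theta> (Forall x A) = Forall x' (sub_ty (\<theta>(x := Var x')) A)"
    using x' by (intro sub_Forall) (auto simp: fv_Forall)
  ultimately show ?case by simp
next
  case (ForallE \<Gamma> t x A a)
  have "finite (\<Union>y\<in>fv_ty A. fv_trm (\<theta> y))"
    by (simp add: finite_fv)
  then obtain x' where x': "x' \<notin> (\<Union>y\<in>fv_ty A. fv_trm (\<theta> y))" "fst x' = fst x"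
    by (rule fresh_var)
  let ?\<eta> = "\<theta>(x := Var x')"
  have "sub_ty \<theta> (Forall x A) = Forall x' (sub_ty ?\<eta> A)"
    using x' by (intro sub_Forall) (auto simp: fv_Forall)
  then have "\<Delta> \<turnstile> sub_sch \<theta> t : Forall x' (sub_ty ?\<eta> A)"
    using ForallE.IH[OF ForallE.prems] by simp
  then have "\<Delta> \<turnstile> TApp (sub_sch \<theta> t) (sub_trm \<theta> a) : sub_ty (single (sub_trm \<theta> a) x') (sub_ty ?\<eta> A)"
    using ForallE x' by (intro typing.ForallE) (auto simp: wf_ty_sub sorted_sub_upd_Var has_sort_sub)
  \<comment> \<open>The two orders of substitution agree because \<open>x'\<close> occurs in no
    image \<open>\<theta> y\<close> with \<open>y\<close> free in \<open>A\<close>.\<close>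
  moreover have "sub_ty (single (sub_trm \<theta> a) x') (sub_ty ?\<eta> A) = sub_ty \<theta> (sub_ty (single a x) A)"
    unfolding sub_sub_ty
  proof (intro sub_cong_ty ballI)
    fix y assume y: "y \<in> fv_ty A"
    show "sub_trm (single (sub_trm \<theta> a) x') (?\<eta> y) = sub_trm \<theta> (single a x y)"
    proof (cases "y = x")
      case False
      have "sub_trm (single (sub_trm \<theta> a) x') (\<theta> y) = \<theta> y"
        using x' y by (intro sub_id_trm) (auto simp: single_def)
      then show ?thesis using False by (simp add: single_def)
    qed (simp add: single_def)
  qed
  ultimately show ?case by simp
next
  case (Conv \<Gamma> t A B)
  then show ?case by (blast intro: typing.Conv E_sub)
qed

lemma typing_sub_fresh:
  assumes "\<Gamma> \<turnstile> t : A" and "sorted_sub L \<theta>" and "\<forall>y\<in>fv_ctx \<Gamma>. \<theta> y = Var y"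
  shows "\<Gamma> \<turnstile> sub_sch \<theta> t : sub_ty \<theta> A"
  using typing_sub[OF assms(1,2)] typing_wf[OF assms(1)] sub_id_ctx[OF assms(3)] by blast

lemma weakening:
  assumes "\<Gamma> \<turnstile> t : A" and "\<Gamma> \<subseteq> \<Delta>" and "is_ctx L \<Delta>"
  shows "\<Delta> \<turnstile> t : A"
  using typing_sub[OF assms(1) sorted_sub_Var, of \<Delta>] assms(2,3)
  by (simp add: sub_Var_sch sub_Var_ty)

text \<open>A derivation reaches a hypothesis \<open>B\<close> of the context only through an
  occurrence of \<open>PVar B\<close>, which puts the free variables of \<open>B\<close> into
  \<open>t\<close>. No enclosing \<open>TLam\<close> removes them, since its variable is not free in
  the context.\<close>

lemma strengthening:
  assumes "\<Gamma> \<turnstile> t : A" and "\<Gamma>' \<subseteq> \<Gamma>" and "{B \<in> \<Gamma>. fv_ty B \<subseteq> fv_sch t} \<subseteq> \<Gamma>'"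
  shows "\<Gamma>' \<turnstile> t : A"
  using assms
proof (induction arbitrary: \<Gamma>' rule: typing.induct)
  case (Ax \<Gamma> A)
  then show ?case by (auto intro!: typing.Ax is_ctx_subset[of L \<Gamma>])
next
  case (ImpI \<Gamma> A t B)
  then show ?case by (intro typing.ImpI ImpI.IH) auto
next
  case (ImpE \<Gamma> t A B u)
  have "\<Gamma>' \<turnstile> t : Imp A B" "\<Gamma>' \<turnstile> u : A"
    using ImpE.prems by (auto intro!: ImpE.IH)
  then show ?case by (rule typing.ImpE)
next
  case (ForallI \<Gamma> t A x)
  have "{B \<in> \<Gamma>. fv_ty B \<subseteq> fv_sch t} \<subseteq> \<Gamma>'"
    using ForallI.prems ForallI.hyps by (auto simp: fv_TLam fv_ctx_def)
  moreover have "x \<notin> fv_ctx \<Gamma>'"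
    using ForallI by (auto simp: fv_ctx_def)
  ultimately show ?case
    using ForallI.prems by (intro typing.ForallI ForallI.IH)
next
  case (ForallE \<Gamma> t x A a)
  have "\<Gamma>' \<turnstile> t : Forall x A"
    using ForallE.prems by (auto intro!: ForallE.IH)
  then show ?case using ForallE.hyps by (intro typing.ForallE)
next
  case (Conv \<Gamma> t A B)
  then show ?case by (blast intro: typing.Conv)
qed


subsection \<open>Inversion\<close>

text \<open>Any derivation may end with conversions, so inversion fixes the type only up to
  \<open>E\<close>; successive conversions are merged by transitivity.\<close>

lemma typing_PVar:
  assumes "\<Gamma> \<turnstile> PVar A : T"
  shows "A \<in> \<Gamma> \<and> (A, T) \<in> E"
  using assms
proof (induction \<Gamma> "PVar A" T rule: typing.induct)
  case (Ax \<Gamma>)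
  then show ?case by (auto simp: is_ctx_def intro: E_refl)
qed (auto simp: TLam_def intro: E_trans)

lemma typing_PLam:
  assumes "\<Gamma> \<turnstile> PLam A t : T"
  shows "\<exists>B. (\<Gamma> \<union> {A} \<turnstile> t : B) \<and> (Imp A B, T) \<in> E"
  using assms
proof (induction \<Gamma> "PLam A t" T rule: typing.induct)
  case (ImpI \<Gamma> B)
  then show ?case
    using typing_wf[OF ImpI.hyps(1)] by (auto simp: is_ctx_def intro: E_refl wf_ty.intros)
next
  case (Conv \<Gamma> A B)
  then show ?case by (blast intro: E_trans)
qed (auto simp: TLam_def)

lemma typing_PApp:
  assumes "\<Gamma> \<turnstile> PApp t u : T"
  shows "\<exists>A B. (\<Gamma> \<turnstile> t : Imp A B) \<and> (\<Gamma> \<turnstile> u : A) \<and> (B, T) \<in> E"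
  using assms
proof (induction \<Gamma> "PApp t u" T rule: typing.induct)
  case (ImpE \<Gamma> A B)
  then have "wf_ty L B"
    using typing_wf[OF typing.ImpE] by blast
  then show ?case using ImpE by (blast intro: E_refl)
next
  case (Conv \<Gamma> A B)
  then show ?case by (blast intro: E_trans)
qed (auto simp: TLam_def)

lemma typing_TApp:
  assumes "\<Gamma> \<turnstile> TApp t a : T"
  shows "\<exists>x A. (\<Gamma> \<turnstile> t : Forall x A) \<and> wf_ty L A \<and> has_sort L a (fst x) \<and>
    (sub_ty (single a x) A, T) \<in> E"
  using assms
proof (induction \<Gamma> "TApp t a" T rule: typing.induct)
  case (ForallE \<Gamma> x A)
  then show ?case by (blast intro: E_refl wf_ty_sub sorted_sub_single)
next
  case (Conv \<Gamma> A B)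
  then show ?case by (blast intro: E_trans)
qed (auto simp: TLam_def)

text \<open>\<open>TLam\<close> is not injective: the derivation may have been built with another
  bound variable and a correspondingly renamed body.\<close>

lemma typing_TLam_raw:
  assumes "\<Gamma> \<turnstile> TLam x t : T"
  shows "\<exists>y t' D. TLam x t = TLam y t' \<and> (\<Gamma> \<turnstile> t' : D) \<and> y \<notin> fv_ctx \<Gamma> \<and> (Forall y D, T) \<in> E"
  using assms
proof (induction \<Gamma> "TLam x t" T rule: typing.induct)
  case (ForallI \<Gamma> t' D y)
  have "wf_ty L (Forall y D)"
    using typing_wf[OF ForallI.hyps(1)] by (simp add: wf_ty.intros)
  then show ?case
    using ForallI by (metis E_refl)
next
  case (Conv \<Gamma> A B)
  then show ?case by (blast intro: E_trans)
qed (auto simp: TLam_def)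

text \<open>The displayed body and the one in the derivation are both renamed to a common fresh
  variable \<open>z\<close>, where they coincide. The set \<open>X\<close> lets each use impose its
  own freshness conditions on \<open>z\<close>.\<close>

lemma typing_TLam:
  assumes T: "\<Gamma> \<turnstile> TLam x t : T" and t: "wf_sch L t" and X: "finite X"
  obtains z D where "z \<notin> X" and "fst z = fst x" and "z \<notin> fv_ctx \<Gamma>"
    and "\<Gamma> \<turnstile> sub_sch (single (Var z) x) t : D" and "(Forall z D, T) \<in> E"
proof -
  obtain y t' D where eq: "TLam x t = TLam y t'" and t': "\<Gamma> \<turnstile> t' : D"
    and y: "y \<notin> fv_ctx \<Gamma>" and E: "(Forall y D, T) \<in> E"
    using typing_TLam_raw[OF T] by blast
  let ?X = "X \<union> fv_ctx \<Gamma> \<union> fv_sch t \<union> fv_sch t' \<union> fv_ty D"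
  have "finite ?X"
    using X typing_wf[OF T] by (simp add: finite_fv finite_fv_ctx is_ctx_def)
  then obtain z where z: "z \<notin> ?X" and zx: "fst z = fst x"
    by (rule fresh_var)
  have zy: "fst z = fst y"
    using zx eq by (simp add: TLam_def)
  have wf: "wf_sch L t'"
    using typing_wf[OF t'] by blast
  have "TLam z (sub_sch (single (Var z) x) t) = TLam z (sub_sch (single (Var z) y) t')"
    using z zx zy eq by (simp add: TLam_rename)
  \<comment> \<open>Injectivity yields equality up to renaming the bound variable; both binders
    being \<open>z\<close>, that renaming is the identity.\<close>
  then have "sub_sch (single (Var z) y) t' = sub_sch (single (Var z) z) (sub_sch (single (Var z) x) t)"
    using t wf zx zy by (intro TLam_inj[of L]) (auto intro!: wf_sch_sub sorted_sub_single_Var)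
  then have "sub_sch (single (Var z) y) t' = sub_sch (single (Var z) x) t"
    by (simp add: sub_id_sch single_def)
  moreover have "\<Gamma> \<turnstile> sub_sch (single (Var z) y) t' : sub_ty (single (Var z) y) D"
    using y by (intro typing_sub_fresh[OF t'] sorted_sub_single_Var zy) (auto simp: single_def)
  moreover have "Forall z (sub_ty (single (Var z) y) D) = Forall y D"
    using z zy by (intro Forall_rename) auto
  ultimately show thesis
    using that[of z "sub_ty (single (Var z) y) D"] z zx E by simp
qed

text \<open>The body is typed with a fresh variable \<open>z\<close> in place of \<open>x\<close>, by a type \<open>D\<close> in which \<open>x\<close> may
  still occur; exchanging \<open>x\<close> and \<open>z\<close> (through \<open>w\<close>) makes the last assumption applicable.\<close>

lemma typing_TLam_transfer:
  assumes T: "\<Gamma> \<turnstile> TLam x t : T" and t: "wf_sch L t"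
    and x: "x \<notin> fv_ctx \<Gamma>" "x \<notin> fv_ctx \<Delta>" and \<Delta>: "finite \<Delta>"
    and step: "\<And>D. \<Gamma> \<turnstile> t : D \<Longrightarrow> \<Delta> \<turnstile> t' : D"
  shows "\<Delta> \<turnstile> TLam x t' : T"
proof -
  let ?X = "{x} \<union> fv_ctx \<Delta> \<union> fv_sch t \<union> fv_sch t'"
  have "finite ?X"
    using \<Delta> by (simp add: finite_fv finite_fv_ctx)
  then obtain z D where z: "z \<notin> ?X" and zx: "fst z = fst x" and z\<Gamma>: "z \<notin> fv_ctx \<Gamma>"
    and D: "\<Gamma> \<turnstile> sub_sch (single (Var z) x) t : D" and E: "(Forall z D, T) \<in> E"
    by (rule typing_TLam[OF T t])
  have "finite (?X \<union> {z} \<union> fv_ctx \<Gamma> \<union> fv_ty D)"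
    using \<Delta> typing_wf[OF T] by (simp add: finite_fv finite_fv_ctx is_ctx_def)
  then obtain w where w: "w \<notin> ?X \<union> {z} \<union> fv_ctx \<Gamma> \<union> fv_ty D" and wx: "fst w = fst x"
    by (rule fresh_var)
  \<comment> \<open>Parking \<open>x\<close> at \<open>w\<close> keeps its occurrences in
    \<open>D\<close> apart from those of \<open>z\<close>, which become \<open>x\<close>. As
    \<open>w\<close> does not occur in \<open>D\<close>, \<open>\<eta>\<close> undoes
    \<open>\<theta>\<close> on \<open>D\<close>.\<close>
  define \<theta> where "\<theta> = (Var(x := Var w, z := Var x) :: 's var \<Rightarrow> ('s, 'f) trm)"
  define \<eta> where "\<eta> = (Var(w := Var x, x := Var z) :: 's var \<Rightarrow> ('s, 'f) trm)"
  have sorted: "sorted_sub L \<theta>" "sorted_sub L \<eta>"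
    using zx wx unfolding \<theta>_def \<eta>_def by (auto intro!: sorted_sub_upd_Var sorted_sub_Var)
  have "\<Gamma> \<turnstile> sub_sch \<theta> (sub_sch (single (Var z) x) t) : sub_ty \<theta> D"
    using x z\<Gamma> by (intro typing_sub_fresh[OF D] sorted) (auto simp: \<theta>_def)
  moreover have "sub_sch \<theta> (sub_sch (single (Var z) x) t) = t"
    unfolding sub_sub_sch using z by (intro sub_id_sch) (auto simp: \<theta>_def single_def)
  ultimately have "\<Delta> \<turnstile> t' : sub_ty \<theta> D"
    using step by simp
  then have "\<Delta> \<turnstile> sub_sch \<eta> t' : sub_ty \<eta> (sub_ty \<theta> D)"
    using x w by (elim typing_sub_fresh[OF _ sorted(2)]) (auto simp: \<eta>_def)
  moreover have "sub_ty \<eta> (sub_ty \<theta> D) = D"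
    unfolding sub_sub_ty using z w by (intro sub_id_ty) (auto simp: \<theta>_def \<eta>_def)
  moreover have "sub_sch \<eta> t' = sub_sch (single (Var z) x) t'"
    using w by (intro sub_cong_sch) (auto simp: \<eta>_def single_def)
  ultimately have "\<Delta> \<turnstile> TLam z (sub_sch (single (Var z) x) t') : Forall z D"
    using z by (auto intro: typing.ForallI)
  then have "\<Delta> \<turnstile> TLam x t' : Forall z D"
    using z zx by (simp add: TLam_rename)
  then show ?thesis
    using E by (rule typing.Conv)
qed


subsection \<open>Substitution of schemes\<close>

text \<open>Of the context used to apply the substitution, only the membership of \<open>A\<close> matters; decoupling
  it from the typing context allows one to discard hypotheses from the latter.\<close>

lemma typing_in_apply:
  assumes "in_apply L [A \<mapsto> u] \<Gamma> t v" and "\<Delta> \<union> {A} \<turnstile> t : T" and "\<Delta> \<turnstile> u : A"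
    and "A \<in> \<Delta> \<longleftrightarrow> A \<in> \<Gamma>"
  shows "\<Delta> \<turnstile> v : T"
  using assms
proof (induction arbitrary: \<Delta> T rule: in_apply.induct)
  case (VarSub B w \<Gamma>)
  then show ?case
    by (auto split: if_splits dest!: typing_PVar intro: typing.Conv)
next
  case (VarKeep B \<Gamma>)
  \<comment> \<open>Since \<open>A\<close> lies in \<open>\<Gamma>\<close>, it also lies in
    \<open>\<Delta>\<close>, so the variable left in place is typable without the added
    hypothesis.\<close>
  then have "B = A" "B \<in> \<Delta>" "(B, T) \<in> E"
    using typing_PVar[OF VarKeep.prems(1)] by (auto split: if_splits)
  then show ?case
    using typing_wf[OF VarKeep.prems(2)] by (auto intro: typing.intros)
next
  case (VarOther B \<Gamma>)
  then have "B \<in> \<Delta>" "(B, T) \<in> E"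
    using typing_PVar[OF VarOther.prems(1)] by auto
  then show ?case
    using typing_wf[OF VarOther.prems(2)] by (auto intro: typing.intros)
next
  case (Lam \<Gamma> C t v)
  obtain B where t: "\<Delta> \<union> {A} \<union> {C} \<turnstile> t : B" and B: "(Imp C B, T) \<in> E"
    using typing_PLam[OF Lam.prems(1)] by blast
  have "is_ctx L (\<Delta> \<union> {C})"
    using typing_wf[OF t] by (auto intro: is_ctx_subset)
  then have "\<Delta> \<union> {C} \<turnstile> u : A"
    by (intro weakening[OF Lam.prems(2)]) auto
  moreover have "\<Delta> \<union> {C} \<union> {A} \<turnstile> t : B"
    using t by (simp add: insert_commute)
  ultimately have "\<Delta> \<union> {C} \<turnstile> v : B"
    using Lam.prems(3) by (intro Lam.IH) auto
  then show ?case
    using B by (blast intro: typing.intros)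
next
  case (App \<Gamma> t v t' v')
  obtain C B where "\<Delta> \<union> {A} \<turnstile> t : Imp C B" "\<Delta> \<union> {A} \<turnstile> t' : C" and B: "(B, T) \<in> E"
    using typing_PApp[OF App.prems(1)] by blast
  then have "\<Delta> \<turnstile> v : Imp C B" "\<Delta> \<turnstile> v' : C"
    using App.prems by (auto intro: App.IH)
  then show ?case
    using B by (blast intro: typing.intros)
next
  case (Gen t x' x \<Gamma> v)
  have x'A: "x' \<notin> fv_ty A" and x'u: "x' \<notin> fv_sch u"
    using Gen.hyps by (auto simp: fv_ssub_def)
  have eq: "TLam x t = TLam x' (sub_sch (single (Var x') x) t)"
    using Gen.hyps by (intro TLam_rename'[symmetric])
  define \<Delta>' where "\<Delta>' = {B \<in> \<Delta>. x' \<notin> fv_ty B}"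
  have ctx: "is_ctx L \<Delta>"
    using typing_wf[OF Gen.prems(2)] by blast
  have sub: "\<Delta>' \<subseteq> \<Delta>"
    by (auto simp: \<Delta>'_def)
  \<comment> \<open>A hypothesis in which \<open>x'\<close> is free cannot have all its free
    variables in \<open>u\<close>, nor in \<open>TLam x t\<close> below, so strengthening may drop
    it.\<close>
  have u: "\<Delta>' \<turnstile> u : A"
    using sub x'u by (intro strengthening[OF Gen.prems(2)]) (auto simp: \<Delta>'_def)
  have "\<Delta>' \<union> {A} \<turnstile> TLam x t : T"
    using sub Gen.hyps by (intro strengthening[OF Gen.prems(1)]) (auto simp: \<Delta>'_def)
  then have "\<Delta>' \<union> {A} \<turnstile> TLam x' (sub_sch (single (Var x') x) t) : T"
    using eq by simp
  then have "\<Delta>' \<turnstile> TLam x' v : T"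
  proof (rule typing_TLam_transfer)
    show "wf_sch L (sub_sch (single (Var x') x) t)"
      using Gen.hyps by (intro wf_sch_sub sorted_sub_single_Var)
    show "x' \<notin> fv_ctx (\<Delta>' \<union> {A})" "x' \<notin> fv_ctx \<Delta>'"
      using x'A by (auto simp: fv_ctx_def \<Delta>'_def)
    show "finite \<Delta>'"
      using ctx sub by (auto simp: is_ctx_def intro: finite_subset)
    \<comment> \<open>As \<open>x'\<close> is not free in \<open>A\<close>, passing from
      \<open>\<Delta>\<close> to \<open>\<Delta>'\<close> preserves whether \<open>A\<close> is a
      member, as the induction hypothesis requires.\<close>
    show "\<Delta>' \<turnstile> v : D" if "\<Delta>' \<union> {A} \<turnstile> sub_sch (single (Var x') x) t : D" for D
      using that u x'A Gen.prems(3) by (intro Gen.IH) (auto simp: \<Delta>'_def)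
  qed
  then show ?case
    using sub ctx by (rule weakening)
next
  case (Inst \<Gamma> t v a)
  obtain x B where "\<Delta> \<union> {A} \<turnstile> t : Forall x B" and B: "wf_ty L B" "has_sort L a (fst x)"
      "(sub_ty (single a x) B, T) \<in> E"
    using typing_TApp[OF Inst.prems(1)] by blast
  then have "\<Delta> \<turnstile> v : Forall x B"
    using Inst.prems by (intro Inst.IH)
  then show ?case
    using B by (blast intro: typing.intros)
qed


subsection \<open>Reduction\<close>

text \<open>Inversion types the function part of the redex by two congruent implications or
  quantifications. Non-confusion transfers the congruence to their components, and conversion then
  repairs the types of the argument and of the result.\<close>

lemma typing_top_red:
  assumes nc: "non_confusing L E" and "top_red L \<Gamma> t t'" and T: "\<Gamma> \<turnstile> t : T"
  shows "\<Gamma> \<turnstile> t' : T"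
  using assms(2)
proof cases
  case (1 A u s)
  obtain C B where s: "\<Gamma> \<turnstile> PLam A s : Imp C B" and u: "\<Gamma> \<turnstile> u : C" and BT: "(B, T) \<in> E"
    using typing_PApp T 1 by blast
  obtain B' where s': "\<Gamma> \<union> {A} \<turnstile> s : B'" and "(Imp A B', Imp C B) \<in> E"
    using typing_PLam[OF s] by blast
  then have AC: "(A, C) \<in> E" and B'B: "(B', B) \<in> E"
    using nc unfolding non_confusing_def by blast+
  have "\<Gamma> \<turnstile> u : A"
    using u AC by (blast intro: typing.Conv E_sym)
  then have "\<Gamma> \<turnstile> t' : B'"
    using 1 s' typing_in_apply[of A u \<Gamma> s t' \<Gamma> B'] by (auto simp: apply_ssub_def)
  then show ?thesis
    using B'B BT by (blast intro: typing.Conv)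
next
  case (2 s a x)
  obtain y A where s: "\<Gamma> \<turnstile> TLam x s : Forall y A" and A: "wf_ty L A"
    and ay: "has_sort L a (fst y)" and AT: "(sub_ty (single a y) A, T) \<in> E"
    using typing_TApp T 2 by blast
  have yx: "fst y = fst x"
    using ay 2 by (blast intro: has_sort_unique)
  have "finite (fv_sch s \<union> fv_ty A)"
    by (simp add: finite_fv)
  with s \<open>wf_sch L s\<close> obtain z D where z: "z \<notin> fv_sch s \<union> fv_ty A" and zx: "fst z = fst x"
    and z\<Gamma>: "z \<notin> fv_ctx \<Gamma>" and D: "\<Gamma> \<turnstile> sub_sch (single (Var z) x) s : D"
    and "(Forall z D, Forall y A) \<in> E"
    by (rule typing_TLam)
  \<comment> \<open>Non-confusion compares bodies under the same bound variable, so
    \<open>Forall y A\<close> is first rewritten with \<open>z\<close>.\<close>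
  then have "(Forall z D, Forall z (sub_ty (single (Var z) y) A)) \<in> E"
    using yx by (simp add: Forall_rename)
  moreover have "wf_ty L D" "wf_ty L (sub_ty (single (Var z) y) A)"
    using typing_wf[OF D] A zx yx by (auto intro!: wf_ty_sub sorted_sub_single_Var)
  ultimately have "(D, sub_ty (single (Var z) y) A) \<in> E"
    using nc unfolding non_confusing_def by blast
  then have "(sub_ty (single a z) D, sub_ty (single a z) (sub_ty (single (Var z) y) A)) \<in> E"
    using ay yx zx by (intro E_single) auto
  moreover have "sub_ty (single a z) (sub_ty (single (Var z) y) A) = sub_ty (single a y) A"
    unfolding sub_sub_ty using z by (intro sub_cong_ty) (auto simp: single_def)
  \<comment> \<open>As \<open>z\<close> is not free in the context, \<open>a\<close> can be
    substituted for it throughout the derivation of the body.\<close>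
  moreover have "\<Gamma> \<turnstile> sub_sch (single a z) (sub_sch (single (Var z) x) s) : sub_ty (single a z) D"
    using z\<Gamma> ay yx zx by (intro typing_sub_fresh[OF D] sorted_sub_single) (auto simp: single_def)
  moreover have "sub_sch (single a z) (sub_sch (single (Var z) x) s) = sub_sch (single a x) s"
    unfolding sub_sub_sch using z by (intro sub_cong_sch) (auto simp: single_def)
  ultimately show ?thesis
    using 2 AT by (auto intro: typing.Conv)
qed

text \<open>The type is generalised in the induction because inversion gives subschemes types that
  are not determined by \<open>T\<close>.\<close>

lemma typing_red:
  assumes nc: "non_confusing L E" and "red L \<Gamma> t t'" and "\<Gamma> \<turnstile> t : T"
  shows "\<Gamma> \<turnstile> t' : T"
  using assms(2,3)
proof (induction arbitrary: T rule: red.induct)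
  case (Top \<Gamma> t t')
  then show ?case by (blast intro: typing_top_red nc)
next
  case (AppL \<Gamma> t t' u)
  then show ?case by (meson typing_PApp typing.ImpE typing.Conv)
next
  case (InstFun \<Gamma> t t' a)
  then show ?case by (meson typing_TApp typing.ForallE typing.Conv)
next
  case (GenBody t x \<Gamma> t')
  \<comment> \<open>The induction hypothesis, valid at every type, is the premise
    \<open>step\<close> of \<open>typing_TLam_transfer\<close>, taken with the same context on both
    sides.\<close>
  then show ?case
    using typing_wf[OF GenBody.prems] by (auto simp: is_ctx_def intro: typing_TLam_transfer)
next
  case (AppR \<Gamma> u u' t)
  then obtain A B where "\<Gamma> \<turnstile> t : Imp A B" "\<Gamma> \<turnstile> u : A" "(B, T) \<in> E"
    using typing_PApp by blast
  then show ?case using AppR.IH by (blast intro: typing.ImpE typing.Conv)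
next
  case (LamBody \<Gamma> A t t')
  then show ?case by (meson typing_PLam typing.ImpI typing.Conv)
qed

end

theorem theorem1:
  fixes L :: "('s, 'f, 'p) lang"
    and E :: "(('s, 'f, 'p) ty \<times> ('s, 'f, 'p) ty) set"
    and \<Gamma> :: "('s, 'f, 'p) ty set"
    and A :: "('s, 'f, 'p) ty"
    and t u :: "('s, 'f, 'p) sch"
  assumes "congruence L E"
    and "non_confusing L E"
    and "is_ctx L \<Gamma>"
    and "wf_ty L A"
    and "wf_sch L t"
    and "typing L E \<Gamma> t A"
    and "reds L \<Gamma> t u"
  shows "typing L E \<Gamma> u A"
proof -
  interpret type_congruence L E
    by unfold_locales (rule assms(1))
  show ?thesis
    using assms(7,6) by (induction rule: rtranclp_induct) (auto intro: typing_red assms(2))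
qed

end
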